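(* Let $X=\mathbb{N}$ or $X=\mathbb{Z}$ and let $B=(b_{ij})_{i,j\in X}$ be a matrix with entries in $\mathbb{R}\cup\{-\infty\}$ satisfying condition (C). (i) If $B$ is $l_0$-strongly regular, then $B$ has a (necessarily unique) locally bounded local strong $l_0$-solution $F$ to its assignment problem such that $\limsup_{i,j\to\infty}\tilde b_{ij}\le 0$ and such that the potentials $\phi$ and $\tilde\phi$ are bounded functions, where $\tilde b,\phi,\tilde\phi$ are the optimal distance, the potential and the inverse potential associated with $B$ and $F$. (ii) If $B$ is $l_1$-strongly regular, then this solution is also a global $l_1$-solution.
   Context: Spaces: $l_1$ and $l_0$ denote the spaces of real functions $s=(s_i)_{i\in X}$ with, respectively, $\sup_n\sum_{|i|\le n}|s_i|<\infty$; the finite limit $\lim_{|n|\to\infty}s_n$ exists. Below $\mathbf{l}$ is one of these. Condition (C): for any $i$ there is $j$ with $b_{ij}\ne-\infty$; for any $j$ there is $i$ with $b_{ij}\neq-\infty$; and $b_{ij}\to-\infty$ as $|i-j|\to\infty$. Operators: $(Bf)_i=\sup_j\{b_{ij}-f_j\}$ and $(B^Tg)_j=\sup_i\{b_{ij}-g_i\}$. $\mathbf{l}$-strong regularity: $B$ is $\mathbf{l}$-strongly regular if there exists $g\in\mathbf{l}$ such that (i) $f:=B^Tg\in\mathbf{l}$, (ii) $f$ is the unique solution in $\mathbb{R}^X$ of the equation $Bf=g$ (with $g$ given), and (iii) $g$ is the unique solution in $\mathbb{R}^X$ of the equation $f=B^Tg$ (with $f$ given). Distance of bijections: for bijections $F,G:X\to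 X$, $\rho(F,G)=\sup_n|F(n)-G(n)|$. $F$ is locally bounded if $\rho(F,\mathrm{id})<\infty$. Solutions to the assignment problem: a bijection $F:X\to X$ is a (global) solution, respectively a strong solution, for $B$ if for every other bijection $G:X\to X$, $$\liminf_{n\to\infty}\sum_{|i|\le n}(b_{iF(i)}-b_{iG(i)})\ge 0,\quad\text{respectively}\quad >0.$$ It is a local (strong) solution if this inequality is required only for those $G\ne F$ with $\rho(F,G)<\infty$. It is an $\mathbf{l}$-solution if the sequence $(b_{iF(i)})_{i\in X}$ belongs to $\mathbf{l}$; it is a locally bounded $\mathbf{l}$-solution if moreover $F$ is locally bounded. Optimal distance and potentials: for a (possibly local) solution $F$, $$\tilde b_{ij}=\sup\bigl[b_{iF(i_1)}-b_{i_1F(i_1)}+b_{i_1F(i_2)}-b_{i_2F(i_2)}+\dots+b_{i_{n-1}F(i_n)}-b_{i_nF(i_n)}+b_{i_nF(j)}-b_{jF(j)}\bigr],$$ the supremum being over all $n=1,2,\dots$ and all collections $i_1,\dots,i_n\in X$; and $\phi_i=\sup_j\tilde b_{ij}$, $\tilde\phi_i=\sup_j\tilde b_{ji}$. *)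

theory Defs
  imports "HOL-Library.Extended_Real"
begin

text \<open>
  The index set is a set \<open>X\<close> of integers (the theorem takes \<open>X = \<nat>\<close> or \<open>X = \<int>\<close>).  Functions on
  \<open>X\<close>, and bijections of \<open>X\<close>, are total functions on the integers of which only the values on \<open>X\<close>
  matter; in particular all equality and uniqueness assertions are made on \<open>X\<close> only.
  Matrices have entries of type \<^typ>\<open>ereal\<close>, the value \<open>\<infinity>\<close> being excluded by hypothesis.
\<close>

definition block :: "int set \<Rightarrow> nat \<Rightarrow> int set" where
  "block X n = {i \<in> X. \<bar>i\<bar> \<le> int n}"

definition infty_on :: "int set \<Rightarrow> int filter" where
  \<comment> \<open>\<open>|n| \<rightarrow> \<infinity>\<close> with \<open>n\<close> in \<open>X\<close>; if \<open>X = \<int>\<close>, both ends are covered simultaneously\<close>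
  "infty_on X = inf (filtercomap abs at_top) (principal X)"

definition l1 :: "int set \<Rightarrow> (int \<Rightarrow> real) set" where
  "l1 X = {s. bdd_above (range (\<lambda>n. \<Sum>i\<in>block X n. \<bar>s i\<bar>))}"

definition l0 :: "int set \<Rightarrow> (int \<Rightarrow> real) set" where
  "l0 X = {s. \<exists>L. (s \<longlongrightarrow> L) (infty_on X)}"

definition condition_C :: "int set \<Rightarrow> (int \<Rightarrow> int \<Rightarrow> ereal) \<Rightarrow> bool" where
  "condition_C X b \<longleftrightarrow>
     (\<forall>i\<in>X. \<exists>j\<in>X. b i j \<noteq> -\<infinity>) \<and>
     (\<forall>j\<in>X. \<exists>i\<in>X. b i j \<noteq> -\<infinity>) \<and>
     ((\<lambda>(i, j). b i j) \<longlongrightarrow> -\<infinity>)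
        (inf (filtercomap (\<lambda>(i, j). \<bar>i - j\<bar>) at_top) (principal (X \<times> X)))"

definition B_op :: "int set \<Rightarrow> (int \<Rightarrow> int \<Rightarrow> ereal) \<Rightarrow> (int \<Rightarrow> real) \<Rightarrow> int \<Rightarrow> ereal" where
  "B_op X b f i = (SUP j\<in>X. b i j - ereal (f j))"

definition BT_op :: "int set \<Rightarrow> (int \<Rightarrow> int \<Rightarrow> ereal) \<Rightarrow> (int \<Rightarrow> real) \<Rightarrow> int \<Rightarrow> ereal" where
  "BT_op X b g j = (SUP i\<in>X. b i j - ereal (g i))"

definition strongly_regular ::
  "int set \<Rightarrow> (int \<Rightarrow> real) set \<Rightarrow> (int \<Rightarrow> int \<Rightarrow> ereal) \<Rightarrow> bool" where
  "strongly_regular X l b \<longleftrightarrow>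
     (\<exists>g\<in>l. \<exists>f\<in>l.
        (\<forall>j\<in>X. ereal (f j) = BT_op X b g j) \<and>
        (\<forall>i\<in>X. B_op X b f i = ereal (g i)) \<and>
        (\<forall>f'. (\<forall>i\<in>X. B_op X b f' i = ereal (g i)) \<longrightarrow> (\<forall>j\<in>X. f' j = f j)) \<and>
        (\<forall>g'. (\<forall>j\<in>X. ereal (f j) = BT_op X b g' j) \<longrightarrow> (\<forall>i\<in>X. g' i = g i)))"

definition rho :: "int set \<Rightarrow> (int \<Rightarrow> int) \<Rightarrow> (int \<Rightarrow> int) \<Rightarrow> ereal" where
  "rho X F G = (SUP n\<in>X. ereal (real_of_int \<bar>F n - G n\<bar>))"

definition locally_bounded :: "int set \<Rightarrow> (int \<Rightarrow> int) \<Rightarrow> bool" where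
  "locally_bounded X F \<longleftrightarrow> rho X F id < \<infinity>"

definition liminf_gain ::
  "int set \<Rightarrow> (int \<Rightarrow> int \<Rightarrow> ereal) \<Rightarrow> (int \<Rightarrow> int) \<Rightarrow> (int \<Rightarrow> int) \<Rightarrow> ereal" where
  "liminf_gain X b F G = liminf (\<lambda>n. \<Sum>i\<in>block X n. b i (F i) - b i (G i))"

text \<open>
  In the next two definitions \<open>b i (F i) \<noteq> -\<infinity>\<close> keeps the meaningless difference \<open>-\<infinity> - (-\<infinity>)\<close>
  (which is \<open>\<infinity>\<close> in \<^typ>\<open>ereal\<close>) from occurring; the summands are then real or \<open>\<infinity>\<close>.
  For \<open>l\<close>-solutions it holds anyway.
\<close>

definition global_solution :: "int set \<Rightarrow> (int \<Rightarrow> int \<Rightarrow> ereal) \<Rightarrow> (int \<Rightarrow> int) \<Rightarrow> bool" where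
  "global_solution X b F \<longleftrightarrow>
     bij_betw F X X \<and> (\<forall>i\<in>X. b i (F i) \<noteq> -\<infinity>) \<and>
     (\<forall>G. bij_betw G X X \<and> (\<exists>i\<in>X. G i \<noteq> F i) \<longrightarrow> liminf_gain X b F G \<ge> 0)"

definition local_strong_solution :: "int set \<Rightarrow> (int \<Rightarrow> int \<Rightarrow> ereal) \<Rightarrow> (int \<Rightarrow> int) \<Rightarrow> bool" where
  "local_strong_solution X b F \<longleftrightarrow>
     bij_betw F X X \<and> (\<forall>i\<in>X. b i (F i) \<noteq> -\<infinity>) \<and>
     (\<forall>G. bij_betw G X X \<and> (\<exists>i\<in>X. G i \<noteq> F i) \<and> rho X F G < \<infinity> \<longrightarrow> liminf_gain X b F G > 0)"

definition values_in ::
  "int set \<Rightarrow> (int \<Rightarrow> real) set \<Rightarrow> (int \<Rightarrow> int \<Rightarrow> ereal) \<Rightarrow> (int \<Rightarrow> int) \<Rightarrow> bool" where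
  \<comment> \<open>what makes a solution \<open>F\<close> an \<open>l\<close>-solution\<close>
  "values_in X l b F \<longleftrightarrow> (\<exists>s\<in>l. \<forall>i\<in>X. b i (F i) = ereal (s i))"

fun path_weight ::
  "(int \<Rightarrow> int \<Rightarrow> ereal) \<Rightarrow> (int \<Rightarrow> int) \<Rightarrow> int \<Rightarrow> int list \<Rightarrow> int \<Rightarrow> ereal" where
  "path_weight b F i [] j = b i (F j) - b j (F j)"
| "path_weight b F i (k # ks) j = (b i (F k) - b k (F k)) + path_weight b F k ks j"

definition opt_dist ::
  "int set \<Rightarrow> (int \<Rightarrow> int \<Rightarrow> ereal) \<Rightarrow> (int \<Rightarrow> int) \<Rightarrow> int \<Rightarrow> int \<Rightarrow> ereal" where
  "opt_dist X b F i j = (SUP ks\<in>{ks. ks \<noteq> [] \<and> set ks \<subseteq> X}. path_weight b F i ks j)"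

definition potential ::
  "int set \<Rightarrow> (int \<Rightarrow> int \<Rightarrow> ereal) \<Rightarrow> (int \<Rightarrow> int) \<Rightarrow> int \<Rightarrow> ereal" where
  "potential X b F i = (SUP j\<in>X. opt_dist X b F i j)"

definition inv_potential ::
  "int set \<Rightarrow> (int \<Rightarrow> int \<Rightarrow> ereal) \<Rightarrow> (int \<Rightarrow> int) \<Rightarrow> int \<Rightarrow> ereal" where
  "inv_potential X b F i = (SUP j\<in>X. opt_dist X b F j i)"

definition bounded_fun_on :: "int set \<Rightarrow> (int \<Rightarrow> ereal) \<Rightarrow> bool" where
  "bounded_fun_on X u \<longleftrightarrow> (\<exists>C::real. \<forall>i\<in>X. \<bar>u i\<bar> \<le> ereal C)"

definition lb_local_strong_l0_solution ::
  "int set \<Rightarrow> (int \<Rightarrow> int \<Rightarrow> ereal) \<Rightarrow> (int \<Rightarrow> int) \<Rightarrow> bool" where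
  "lb_local_strong_l0_solution X b F \<longleftrightarrow>
     local_strong_solution X b F \<and> locally_bounded X F \<and> values_in X (l0 X) b F"

definition distinguished_solution ::
  "int set \<Rightarrow> (int \<Rightarrow> int \<Rightarrow> ereal) \<Rightarrow> (int \<Rightarrow> int) \<Rightarrow> bool" where
  \<comment> \<open>Uniqueness is among all locally bounded local strong \<open>l0\<close>-solutions, whether or not they
     satisfy the conditions on the optimal distance and the potentials.\<close>
  "distinguished_solution X b F \<longleftrightarrow>
     lb_local_strong_l0_solution X b F \<and>
     (\<forall>G. lb_local_strong_l0_solution X b G \<longrightarrow> (\<forall>i\<in>X. G i = F i)) \<and>
     Limsup (infty_on X \<times>\<^sub>F infty_on X) (\<lambda>(i, j). opt_dist X b F i j) \<le> 0 \<and>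
     bounded_fun_on X (potential X b F) \<and>
     bounded_fun_on X (inv_potential X b F)"

end

theory Submission
  imports Defs "HOL-Analysis.Infinite_Sum"
begin

text \<open>
  Let \<open>g\<close> and \<open>f = B\<^sup>T g\<close> witness strong regularity.  Then \<open>b i j \<le> g i + f j\<close> always, so \<open>(f, g)\<close> is
  feasible for the linear program dual to the assignment problem.  Call an entry tight if equality
  holds.  Since \<open>f\<close> is bounded and \<open>b i j \<rightarrow> -\<infinity>\<close> away from the diagonal, the suprema defining
  \<open>B f = g\<close> and \<open>B\<^sup>T g = f\<close> are attained, that is, every row and every column has a tight entry.

  The two uniqueness assertions force the tight entries to form the graph of a bijection \<open>F\<close>.  If
  raising the single value \<open>f j\<close> destroyed no row supremum, \<open>f\<close> would not be unique; hence for each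
  \<open>j\<close> there is a row whose only tight entry lies in column \<open>j\<close>, and dually for each \<open>i\<close> there is a
  column whose only tight entry lies in row \<open>i\<close>.  These two choice maps are injective and inverse to
  each other (lemma \<open>exclusive_relation_is_bijection\<close>).

  Everything else is complementary slackness for \<open>F\<close>.  Each step of a path from \<open>i\<close> to \<open>j\<close> weighs at
  most the drop of \<open>g\<close> along it, so the optimal distance is at most \<open>g i - g j\<close>; as \<open>g\<close> is bounded
  and has a limit at infinity, this yields the assertions about the distance and the potentials.  For
  a competitor \<open>G\<close>, the gain of \<open>F\<close> over \<open>G\<close> on a large block is at least the sum of \<open>f (F i) - f (G i)\<close>
  over the block, plus a fixed \<open>\<delta> > 0\<close> coming from one index where \<open>F\<close> and \<open>G\<close> differ
  (lemma \<open>liminf_gain_pos\<close>).  So it is enough that these sums tend to zero.  If \<open>f\<close> has a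
  limit and \<open>F\<close>, \<open>G\<close> are locally bounded, the two images of a block have equal cardinality and differ
  only in boundedly many points near its boundary, where \<open>f\<close> is almost constant.  If \<open>f\<close> is
  absolutely summable, both sums converge to the total sum of \<open>f\<close>, whatever the bijection \<open>G\<close> is.
\<close>

section \<open>Blocks, limits at infinity and sequence spaces\<close>

lemma finite_block [simp]: "finite (block X n)"
  by (rule finite_subset[of _ "{- int n..int n}"]) (auto simp: block_def)

lemma block_subset: "block X n \<subseteq> X"
  by (auto simp: block_def)

lemma finite_subset_block:
  assumes "finite A" "A \<subseteq> X"
  shows "\<exists>m. \<forall>n\<ge>m. A \<subseteq> block X n"
  using assms
proof (induction A rule: finite_induct)
  case (insert x A)
  then obtain m where m: "\<forall>n\<ge>m. A \<subseteq> block X n" by auto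
  with insert.prems have "\<forall>n \<ge> max m (nat \<bar>x\<bar>). insert x A \<subseteq> block X n"
    by (auto simp: block_def)
  then show ?case by blast
qed auto

lemma filterlim_block: "filterlim (block X) (finite_subsets_at_top X) sequentially"
  unfolding filterlim_finite_subsets_at_top eventually_sequentially
  using finite_subset_block[of _ X] by (simp add: block_subset)

lemma eventually_infty_on:
  "eventually P (infty_on X) \<longleftrightarrow> (\<exists>m. \<forall>i\<in>X. m \<le> \<bar>i\<bar> \<longrightarrow> P i)"
  unfolding infty_on_def eventually_inf_principal eventually_filtercomap_at_top_linorder
  by blast

lemma l0_D:
  assumes "s \<in> l0 X"
  obtains L where "\<And>e. e > 0 \<Longrightarrow> \<exists>m. \<forall>i\<in>X. m \<le> \<bar>i\<bar> \<longrightarrow> \<bar>s i - L\<bar> < e"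
  using assms unfolding l0_def tendsto_iff eventually_infty_on dist_real_def by blast

lemma l0_I:
  assumes "\<And>e. e > 0 \<Longrightarrow> \<exists>m. \<forall>i\<in>X. m \<le> \<bar>i\<bar> \<longrightarrow> \<bar>s i - L\<bar> < e"
  shows "s \<in> l0 X"
  using assms unfolding l0_def tendsto_iff eventually_infty_on dist_real_def by blast

lemma l0_bounded:
  assumes "s \<in> l0 X"
  shows "\<exists>K. \<forall>i\<in>X. \<bar>s i\<bar> \<le> K"
proof -
  obtain L where "\<And>e. e > 0 \<Longrightarrow> \<exists>m. \<forall>i\<in>X. m \<le> \<bar>i\<bar> \<longrightarrow> \<bar>s i - L\<bar> < e"
    using l0_D[OF assms] by blast
  from this[of 1] obtain m where m: "\<forall>i\<in>X. m \<le> \<bar>i\<bar> \<longrightarrow> \<bar>s i - L\<bar> < 1" by auto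
  let ?K = "Max (insert (\<bar>L\<bar> + 1) ((\<lambda>i. \<bar>s i\<bar>) ` block X (nat m)))"
  have "\<bar>s i\<bar> \<le> ?K" if "i \<in> X" for i
  proof (cases "m \<le> \<bar>i\<bar>")
    case True
    with m that have "\<bar>s i\<bar> \<le> \<bar>L\<bar> + 1" by fastforce
    also have "\<dots> \<le> ?K" by (intro Max_ge) auto
    finally show ?thesis .
  next
    case False
    with that have "i \<in> block X (nat m)" by (auto simp: block_def)
    then show ?thesis by (intro Max_ge) auto
  qed
  then show ?thesis by blast
qed

lemma l1_abs_summable:
  assumes "s \<in> l1 X"
  shows "(\<lambda>i. \<bar>s i\<bar>) summable_on X"
proof (rule nonneg_bdd_above_summable_on)
  obtain C where C: "\<And>n. (\<Sum>i\<in>block X n. \<bar>s i\<bar>) \<le> C"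
    using assms by (auto simp: l1_def bdd_above_def)
  have "(\<Sum>i\<in>A. \<bar>s i\<bar>) \<le> C" if A: "A \<subseteq> X" "finite A" for A
  proof -
    obtain n where "A \<subseteq> block X n" using finite_subset_block[OF A(2,1)] by blast
    then have "(\<Sum>i\<in>A. \<bar>s i\<bar>) \<le> (\<Sum>i\<in>block X n. \<bar>s i\<bar>)" by (intro sum_mono2) auto
    with C[of n] show ?thesis by linarith
  qed
  then show "bdd_above (sum (\<lambda>i. \<bar>s i\<bar>) ` {F. F \<subseteq> X \<and> finite F})"
    by (intro bdd_aboveI[of _ C]) auto
qed simp

lemma abs_summable_l1:
  assumes "(\<lambda>i. \<bar>s i\<bar>) summable_on X"
  shows "s \<in> l1 X"
  unfolding l1_def using assms
  by (auto intro!: bdd_aboveI[of _ "\<Sum>\<^sub>\<infinity>i\<in>X. \<bar>s i\<bar>"] finite_sum_le_infsum block_subset)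

text \<open>
  Only finitely many terms of an absolutely summable family exceed a given positive bound, because
  the number of such terms is controlled by the total sum.
\<close>

lemma l1_subset_l0: "l1 X \<subseteq> l0 X"
proof
  fix s assume s: "s \<in> l1 X"
  show "s \<in> l0 X"
  proof (rule l0_I[where L = 0])
    fix e :: real assume e: "e > 0"
    let ?A = "{i \<in> X. e \<le> \<bar>s i\<bar>}"
    let ?C = "\<Sum>\<^sub>\<infinity>i\<in>X. \<bar>s i\<bar>"
    have "card A \<le> nat \<lfloor>?C / e\<rfloor>" if A: "A \<subseteq> ?A" "finite A" for A
    proof -
      have "real (card A) * e \<le> (\<Sum>i\<in>A. \<bar>s i\<bar>)"
        using A by (intro sum_bounded_below) auto
      also have "\<dots> \<le> ?C"
        using A l1_abs_summable[OF s] by (intro finite_sum_le_infsum) auto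
      finally have "real (card A) \<le> ?C / e" using e by (simp add: field_simps)
      then show ?thesis by linarith
    qed
    then have "finite ?A" using finite_if_finite_subsets_card_bdd by blast
    then obtain n where "?A \<subseteq> block X n" using finite_subset_block[of ?A X] by auto
    then have "\<forall>i\<in>X. int n + 1 \<le> \<bar>i\<bar> \<longrightarrow> \<bar>s i - 0\<bar> < e" by (force simp: block_def)
    then show "\<exists>m. \<forall>i\<in>X. m \<le> \<bar>i\<bar> \<longrightarrow> \<bar>s i - 0\<bar> < e" by blast
  qed
qed

lemma locally_bounded_iff:
  "locally_bounded X F \<longleftrightarrow> (\<exists>K::nat. \<forall>i\<in>X. \<bar>F i - i\<bar> \<le> int K)"
proof
  assume "locally_bounded X F"
  then obtain c :: real where "rho X F id \<le> ereal c"
    unfolding locally_bounded_def by (cases "rho X F id") auto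
  then have c: "real_of_int \<bar>F i - i\<bar> \<le> c" if "i \<in> X" for i
    using that by (simp add: rho_def SUP_le_iff del: of_int_abs)
  have "\<bar>F i - i\<bar> \<le> int (nat \<lceil>c\<rceil>)" if "i \<in> X" for i
    using c[OF that] by linarith
  then show "\<exists>K::nat. \<forall>i\<in>X. \<bar>F i - i\<bar> \<le> int K" by blast
next
  assume "\<exists>K::nat. \<forall>i\<in>X. \<bar>F i - i\<bar> \<le> int K"
  then obtain K :: nat where K: "\<forall>i\<in>X. \<bar>F i - i\<bar> \<le> int K" by blast
  have "real_of_int \<bar>F i - i\<bar> \<le> real K" if "i \<in> X" for i
    using K that by (metis of_int_le_iff of_int_of_nat_eq)
  then have "rho X F id \<le> ereal (real K)"
    by (auto simp: rho_def SUP_le_iff)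
  also have "\<dots> < \<infinity>" by simp
  finally show "locally_bounded X F" by (simp add: locally_bounded_def)
qed

lemma rho_symmetric: "rho X F G = rho X G F"
  by (simp add: rho_def abs_minus_commute)

lemma rho_triangle: "rho X F H \<le> rho X F G + rho X G H"
  unfolding rho_def
proof (rule SUP_least)
  fix n assume n: "n \<in> X"
  have "ereal (real_of_int \<bar>F n - H n\<bar>)
      \<le> ereal (real_of_int \<bar>F n - G n\<bar>) + ereal (real_of_int \<bar>G n - H n\<bar>)" by simp
  also have "\<dots> \<le> (SUP n\<in>X. ereal (real_of_int \<bar>F n - G n\<bar>))
      + (SUP n\<in>X. ereal (real_of_int \<bar>G n - H n\<bar>))"
    using n by (intro add_mono SUP_upper)
  finally show "ereal (real_of_int \<bar>F n - H n\<bar>)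
      \<le> (SUP n\<in>X. ereal (real_of_int \<bar>F n - G n\<bar>))
        + (SUP n\<in>X. ereal (real_of_int \<bar>G n - H n\<bar>))" .
qed

section \<open>Tight entries form the graph of a bijection\<close>

lemma condition_C_band:
  assumes "condition_C X b"
  shows "\<exists>N. \<forall>i\<in>X. \<forall>j\<in>X. N \<le> \<bar>i - j\<bar> \<longrightarrow> b i j < ereal M"
proof -
  have "eventually (\<lambda>(i, j). b i j < ereal M)
      (inf (filtercomap (\<lambda>(i, j). \<bar>i - j\<bar>) at_top) (principal (X \<times> X)))"
    using assms unfolding condition_C_def tendsto_MInfty by (auto simp: case_prod_unfold)
  then show ?thesis
    unfolding eventually_inf_principal eventually_filtercomap_at_top_linorder by force
qed

definition tight :: "(int \<Rightarrow> int \<Rightarrow> ereal) \<Rightarrow> (int \<Rightarrow> real) \<Rightarrow> (int \<Rightarrow> real) \<Rightarrow> int \<Rightarrow> int \<Rightarrow> bool" where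
  "tight b f g i j \<longleftrightarrow> b i j = ereal (g i + f j)"

lemma BT_op_transpose: "BT_op X b = B_op X (\<lambda>i j. b j i)"
  by (intro ext) (simp add: BT_op_def B_op_def)

lemma tight_transpose: "tight (\<lambda>i j. b j i) g f j i \<longleftrightarrow> tight b f g i j"
  by (simp add: tight_def add.commute)

lemma B_op_le_iff:
  "B_op X b f i \<le> ereal c \<longleftrightarrow> (\<forall>j\<in>X. b i j \<le> ereal (c + f j))"
  by (simp add: B_op_def SUP_le_iff ereal_minus_le)

text \<open>
  Only the finitely many entries of the row close to the diagonal can come near the supremum.
\<close>

lemma B_op_attained:
  assumes band: "\<And>M. \<exists>N. \<forall>i\<in>X. \<forall>j\<in>X. N \<le> \<bar>i - j\<bar> \<longrightarrow> b i j < ereal M"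
    and f: "\<forall>j\<in>X. \<bar>f j\<bar> \<le> K"
    and eq: "B_op X b f i = ereal (g i)" and i: "i \<in> X"
  shows "\<exists>j\<in>X. tight b f g i j"
proof (rule ccontr)
  assume "\<not> ?thesis"
  then have ne: "b i j \<noteq> ereal (g i + f j)" if "j \<in> X" for j
    using that by (auto simp: tight_def)
  have le: "b i j \<le> ereal (g i + f j)" if "j \<in> X" for j
    using eq that B_op_le_iff[of X b f i "g i"] by auto
  obtain N where N: "\<forall>k\<in>X. \<forall>j\<in>X. N \<le> \<bar>k - j\<bar> \<longrightarrow> b k j < ereal (g i - 1 - K)"
    using band[of "g i - 1 - K"] by blast
  let ?J = "{j \<in> X. \<bar>i - j\<bar> < N}"
  have fin: "finite ?J"
    by (rule finite_subset[of _ "{i - N..i + N}"]) auto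
  let ?a = "Max (insert (ereal (g i - 1)) ((\<lambda>j. b i j - ereal (f j)) ` ?J))"
  have "b i j - ereal (f j) < ereal (g i)" if "j \<in> X" for j
    using le[OF that] ne[OF that] by (simp add: ereal_minus_less)
  then have "?a < ereal (g i)"
    using fin by (subst Max_less_iff) auto
  moreover have "B_op X b f i \<le> ?a"
    unfolding B_op_def
  proof (rule SUP_least)
    fix j assume j: "j \<in> X"
    show "b i j - ereal (f j) \<le> ?a"
    proof (cases "\<bar>i - j\<bar> < N")
      case True
      with j fin show ?thesis by (intro Max_ge) auto
    next
      case False
      with N i j have "b i j < ereal (g i - 1 - K)" by auto
      also have "\<dots> \<le> ereal (g i - 1 + f j)" using f j by fastforce
      finally have "b i j - ereal (f j) \<le> ereal (g i - 1)" by (simp add: ereal_minus_le)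
      also have "\<dots> \<le> ?a" using fin by (intro Max_ge) auto
      finally show ?thesis .
    qed
  qed
  ultimately show False using eq by simp
qed

text \<open>
  If every row had a tight entry outside column \<open>j\<close>, the function obtained from \<open>f\<close> by raising its
  value at \<open>j\<close> would also solve the equation.
\<close>

lemma unique_solution_exclusive_row:
  assumes eq: "\<forall>i\<in>X. B_op X b f i = ereal (g i)"
    and att: "\<forall>i\<in>X. \<exists>j\<in>X. tight b f g i j"
    and uniq: "\<forall>f'. (\<forall>i\<in>X. B_op X b f' i = ereal (g i)) \<longrightarrow> (\<forall>j\<in>X. f' j = f j)"
    and j: "j \<in> X"
  shows "\<exists>i\<in>X. tight b f g i j \<and> (\<forall>j'\<in>X. tight b f g i j' \<longrightarrow> j' = j)"
proof (rule ccontr)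
  assume "\<not> ?thesis"
  with att have other: "\<forall>i\<in>X. \<exists>j'\<in>X. j' \<noteq> j \<and> tight b f g i j'" by metis
  let ?f = "f(j := f j + 1)"
  have "B_op X b ?f i = ereal (g i)" if i: "i \<in> X" for i
  proof (rule antisym)
    have "b i k \<le> ereal (g i + ?f k)" if "k \<in> X" for k
    proof -
      have "b i k \<le> ereal (g i + f k)"
        using eq i that B_op_le_iff[of X b f i "g i"] by auto
      also have "\<dots> \<le> ereal (g i + ?f k)" by simp
      finally show ?thesis .
    qed
    then show "B_op X b ?f i \<le> ereal (g i)" by (simp add: B_op_le_iff)
    obtain k where k: "k \<in> X" "k \<noteq> j" "tight b f g i k" using other i by blast
    have "ereal (g i) = b i k - ereal (?f k)" using k by (simp add: tight_def)
    also have "\<dots> \<le> B_op X b ?f i" unfolding B_op_def using k(1) by (rule SUP_upper)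
    finally show "ereal (g i) \<le> B_op X b ?f i" .
  qed
  with uniq have "\<forall>j'\<in>X. ?f j' = f j'" by blast
  with j show False by force
qed

text \<open>
  Sending \<open>j\<close> to a row in which only \<open>j\<close> is related, and \<open>i\<close> to a column in which only \<open>i\<close> is
  related, gives two maps.  The row chosen for the column of \<open>i\<close> is related to that column, hence it
  is \<open>i\<close>; so every row is one that has a single related column.
\<close>

lemma exclusive_relation_is_bijection:
  assumes row: "\<forall>j\<in>X. \<exists>i\<in>X. T i j \<and> (\<forall>j'\<in>X. T i j' \<longrightarrow> j' = j)"
    and col: "\<forall>i\<in>X. \<exists>j\<in>X. T i j \<and> (\<forall>i'\<in>X. T i' j \<longrightarrow> i' = i)"
  shows "\<exists>F. bij_betw F X X \<and> (\<forall>i\<in>X. \<forall>j\<in>X. T i j \<longleftrightarrow> j = F i)"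
proof -
  from row obtain R where
    R: "\<And>j. j \<in> X \<Longrightarrow> R j \<in> X \<and> T (R j) j \<and> (\<forall>j'\<in>X. T (R j) j' \<longrightarrow> j' = j)" by metis
  from col obtain F where
    F: "\<And>i. i \<in> X \<Longrightarrow> F i \<in> X \<and> T i (F i) \<and> (\<forall>i'\<in>X. T i' (F i) \<longrightarrow> i' = i)" by metis
  have RF: "R (F i) = i" if "i \<in> X" for i using R F that by blast
  have FR: "F (R j) = j" if "j \<in> X" for j using R F that by blast
  have "bij_betw F X X"
    by (rule bij_betw_byWitness[where f' = R]) (use R F RF FR in auto)
  moreover have "\<forall>i\<in>X. \<forall>j\<in>X. T i j \<longleftrightarrow> j = F i" using R F RF by metis
  ultimately show ?thesis by blast
qed

text \<open>
  Strict complementary slackness: \<open>(f, g)\<close> is dual feasible and its tight entries are exactly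
  those of the assignment \<open>F\<close>.
\<close>

definition strictly_complementary ::
  "int set \<Rightarrow> (int \<Rightarrow> int \<Rightarrow> ereal) \<Rightarrow> (int \<Rightarrow> real) \<Rightarrow> (int \<Rightarrow> real) \<Rightarrow> (int \<Rightarrow> int) \<Rightarrow> bool" where
  "strictly_complementary X b f g F \<longleftrightarrow>
     bij_betw F X X \<and>
     (\<forall>i\<in>X. \<forall>j\<in>X. b i j \<le> ereal (g i + f j)) \<and>
     (\<forall>i\<in>X. \<forall>j\<in>X. b i j = ereal (g i + f j) \<longleftrightarrow> j = F i)"

lemma strongly_regular_complementary:
  assumes C: "condition_C X b" and reg: "strongly_regular X l b" and l: "l \<subseteq> l0 X"
  obtains f g F where "f \<in> l" "g \<in> l" "strictly_complementary X b f g F"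
proof -
  obtain g f where fg: "g \<in> l" "f \<in> l"
    and BT': "\<forall>j\<in>X. ereal (f j) = B_op X (\<lambda>i j. b j i) g j"
    and B: "\<forall>i\<in>X. B_op X b f i = ereal (g i)"
    and uf: "\<forall>f'. (\<forall>i\<in>X. B_op X b f' i = ereal (g i)) \<longrightarrow> (\<forall>j\<in>X. f' j = f j)"
    and ug': "\<forall>g'. (\<forall>j\<in>X. ereal (f j) = B_op X (\<lambda>i j. b j i) g' j) \<longrightarrow> (\<forall>i\<in>X. g' i = g i)"
    using reg unfolding strongly_regular_def BT_op_transpose by (elim bexE conjE) (rule that)
  have BT: "\<forall>j\<in>X. B_op X (\<lambda>i j. b j i) g j = ereal (f j)"
    using BT' by simp
  have ug: "\<forall>g'. (\<forall>j\<in>X. B_op X (\<lambda>i j. b j i) g' j = ereal (f j)) \<longrightarrow> (\<forall>i\<in>X. g' i = g i)"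
    using ug' by simp
  obtain K K' where K: "\<forall>i\<in>X. \<bar>f i\<bar> \<le> K" and K': "\<forall>i\<in>X. \<bar>g i\<bar> \<le> K'"
    using fg l l0_bounded by blast
  have band: "\<exists>N. \<forall>i\<in>X. \<forall>j\<in>X. N \<le> \<bar>i - j\<bar> \<longrightarrow> b i j < ereal M" for M
    by (rule condition_C_band[OF C])
  have bandT: "\<exists>N. \<forall>i\<in>X. \<forall>j\<in>X. N \<le> \<bar>i - j\<bar> \<longrightarrow> b j i < ereal M" for M
    using band[of M] by (metis abs_minus_commute)
  have rows: "\<forall>j\<in>X. \<exists>i\<in>X. tight b f g i j \<and> (\<forall>j'\<in>X. tight b f g i j' \<longrightarrow> j' = j)"
    using unique_solution_exclusive_row[OF B _ uf] B_op_attained[OF band K] B by blast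
  have "\<forall>i\<in>X. \<exists>j\<in>X. tight (\<lambda>i j. b j i) g f j i
      \<and> (\<forall>i'\<in>X. tight (\<lambda>i j. b j i) g f j i' \<longrightarrow> i' = i)"
    using unique_solution_exclusive_row[OF BT _ ug] B_op_attained[OF bandT K'] BT by blast
  then have cols: "\<forall>i\<in>X. \<exists>j\<in>X. tight b f g i j \<and> (\<forall>i'\<in>X. tight b f g i' j \<longrightarrow> i' = i)"
    unfolding tight_transpose[where b = b] .
  obtain F where F: "bij_betw F X X" "\<forall>i\<in>X. \<forall>j\<in>X. tight b f g i j \<longleftrightarrow> j = F i"
    using exclusive_relation_is_bijection[where T = "tight b f g", OF rows cols] by metis
  have "B_op X b f i \<le> ereal (g i)" if "i \<in> X" for i
    using B that by simp
  then have "\<forall>i\<in>X. \<forall>j\<in>X. b i j \<le> ereal (g i + f j)"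
    unfolding B_op_le_iff by blast
  with F have "strictly_complementary X b f g F"
    by (simp add: strictly_complementary_def tight_def)
  with fg(2,1) show thesis by (rule that)
qed

section \<open>Consequences of complementary slackness\<close>

lemma complementaryD:
  assumes "strictly_complementary X b f g F" "i \<in> X"
  shows "F i \<in> X" "b i (F i) = ereal (g i + f (F i))"
    "j \<in> X \<Longrightarrow> b i j \<le> ereal (g i + f j)"
    "j \<in> X \<Longrightarrow> j \<noteq> F i \<Longrightarrow> b i j < ereal (g i + f j)"
proof -
  from assms have bij: "bij_betw F X X"
    and le: "\<And>j. j \<in> X \<Longrightarrow> b i j \<le> ereal (g i + f j)"
    and eq: "\<And>j. j \<in> X \<Longrightarrow> b i j = ereal (g i + f j) \<longleftrightarrow> j = F i"
    by (simp_all add: strictly_complementary_def)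
  show F: "F i \<in> X" using bij assms(2) by (rule bij_betw_apply)
  show "b i (F i) = ereal (g i + f (F i))" using eq[OF F] by simp
  show "j \<in> X \<Longrightarrow> b i j \<le> ereal (g i + f j)" by (rule le)
  show "j \<in> X \<Longrightarrow> j \<noteq> F i \<Longrightarrow> b i j < ereal (g i + f j)"
    using le[of j] eq[of j] by (simp add: less_le)
qed

lemma complementary_locally_bounded:
  assumes sc: "strictly_complementary X b f g F" and C: "condition_C X b"
    and f: "f \<in> l0 X" and g: "g \<in> l0 X"
  shows "locally_bounded X F"
proof -
  obtain K K' where K: "\<forall>i\<in>X. \<bar>f i\<bar> \<le> K" "\<forall>i\<in>X. \<bar>g i\<bar> \<le> K'"
    using f g l0_bounded by blast
  obtain N where N: "\<forall>i\<in>X. \<forall>j\<in>X. N \<le> \<bar>i - j\<bar> \<longrightarrow> b i j < ereal (- K - K')"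
    using condition_C_band[OF C] by blast
  have "\<bar>F i - i\<bar> \<le> int (nat N)" if i: "i \<in> X" for i
  proof -
    have "- K - K' \<le> g i + f (F i)"
      using K i complementaryD(1)[OF sc i] by (smt (verit))
    then have "\<not> b i (F i) < ereal (- K - K')"
      using complementaryD(2)[OF sc i] by simp
    with N i complementaryD(1)[OF sc i] have "\<bar>i - F i\<bar> < N" by (meson not_le)
    then show ?thesis by linarith
  qed
  then show ?thesis unfolding locally_bounded_iff by blast
qed

lemma complementary_values_l0:
  assumes sc: "strictly_complementary X b f g F" and lb: "locally_bounded X F"
    and f: "f \<in> l0 X" and g: "g \<in> l0 X"
  shows "values_in X (l0 X) b F"
proof -
  obtain K :: nat where K: "\<forall>i\<in>X. \<bar>F i - i\<bar> \<le> int K"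
    using lb unfolding locally_bounded_iff by blast
  obtain L where L: "\<And>e. e > 0 \<Longrightarrow> \<exists>m. \<forall>i\<in>X. m \<le> \<bar>i\<bar> \<longrightarrow> \<bar>f i - L\<bar> < e"
    using l0_D[OF f] by blast
  obtain L' where L': "\<And>e. e > 0 \<Longrightarrow> \<exists>m. \<forall>i\<in>X. m \<le> \<bar>i\<bar> \<longrightarrow> \<bar>g i - L'\<bar> < e"
    using l0_D[OF g] by blast
  have "(\<lambda>i. g i + f (F i)) \<in> l0 X"
  proof (rule l0_I[where L = "L' + L"])
    fix e :: real assume "e > 0"
    then obtain m m' where m: "\<forall>i\<in>X. m \<le> \<bar>i\<bar> \<longrightarrow> \<bar>f i - L\<bar> < e / 2"
      and m': "\<forall>i\<in>X. m' \<le> \<bar>i\<bar> \<longrightarrow> \<bar>g i - L'\<bar> < e / 2"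
      using L[of "e / 2"] L'[of "e / 2"] by auto
    have "\<bar>g i + f (F i) - (L' + L)\<bar> < e" if i: "i \<in> X" "max (m + int K) m' \<le> \<bar>i\<bar>" for i
    proof -
      have "m \<le> \<bar>F i\<bar>" using bspec[OF K i(1)] i(2) by linarith
      then have "\<bar>f (F i) - L\<bar> < e / 2" using m complementaryD(1)[OF sc i(1)] by blast
      moreover have "\<bar>g i - L'\<bar> < e / 2" using m' i by auto
      ultimately show ?thesis by linarith
    qed
    then show "\<exists>m. \<forall>i\<in>X. m \<le> \<bar>i\<bar> \<longrightarrow> \<bar>g i + f (F i) - (L' + L)\<bar> < e" by blast
  qed
  then show ?thesis
    unfolding values_in_def using complementaryD(2)[OF sc]
    by (intro bexI[of _ "\<lambda>i. g i + f (F i)"]) auto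
qed

lemma complementary_values_l1:
  assumes sc: "strictly_complementary X b f g F" and f: "f \<in> l1 X" and g: "g \<in> l1 X"
  shows "values_in X (l1 X) b F"
proof -
  have bij: "bij_betw F X X" using sc by (simp add: strictly_complementary_def)
  have "(\<lambda>i. \<bar>g i\<bar> + \<bar>f (F i)\<bar>) summable_on X"
    using l1_abs_summable[OF g] l1_abs_summable[OF f]
      summable_on_reindex_bij_betw[OF bij, of "\<lambda>i. \<bar>f i\<bar>"]
    by (intro summable_on_add) auto
  then have "(\<lambda>i. \<bar>g i + f (F i)\<bar>) summable_on X"
    by (rule summable_on_comparison_test) (auto simp: abs_triangle_ineq)
  then have "(\<lambda>i. g i + f (F i)) \<in> l1 X" by (rule abs_summable_l1)
  then show ?thesis
    unfolding values_in_def using complementaryD(2)[OF sc]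
    by (intro bexI[of _ "\<lambda>i. g i + f (F i)"]) auto
qed

text \<open>
  The contributions of \<open>f\<close> to a step cancel and those of \<open>g\<close> telescope; what remains, the slacks of
  the entries used, is nonpositive.
\<close>

lemma path_weight_le:
  assumes sc: "strictly_complementary X b f g F"
  shows "i \<in> X \<Longrightarrow> j \<in> X \<Longrightarrow> set ks \<subseteq> X \<Longrightarrow> path_weight b F i ks j \<le> ereal (g i - g j)"
proof (induction ks arbitrary: i)
  have step: "b i (F k) - b k (F k) \<le> ereal (g i - g k)" if "i \<in> X" "k \<in> X" for i k
    using complementaryD(3)[OF sc that(1) complementaryD(1)[OF sc that(2)]]
      complementaryD(2)[OF sc that(2)]
    by (simp add: ereal_minus_le algebra_simps)
  {
    case Nil
    then show ?case using step by simp
  next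
    case (Cons k ks)
    have "path_weight b F i (k # ks) j \<le> ereal (g i - g k) + ereal (g k - g j)"
      unfolding path_weight.simps using Cons.prems by (intro add_mono step Cons.IH) auto
    then show ?case by simp
  }
qed

lemma opt_dist_le:
  assumes "strictly_complementary X b f g F" "i \<in> X" "j \<in> X"
  shows "opt_dist X b F i j \<le> ereal (g i - g j)"
  unfolding opt_dist_def by (rule SUP_least) (use path_weight_le[OF assms] in blast)

text \<open>The one-point path through \<open>i\<close> itself has weight zero.\<close>

lemma opt_dist_refl:
  assumes sc: "strictly_complementary X b f g F" and i: "i \<in> X"
  shows "0 \<le> opt_dist X b F i i"
proof -
  have "0 = path_weight b F i [i] i" using complementaryD(2)[OF sc i] by simp
  also have "\<dots> \<le> opt_dist X b F i i"
    unfolding opt_dist_def using i by (intro SUP_upper) auto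
  finally show ?thesis .
qed

lemma Limsup_opt_dist:
  assumes sc: "strictly_complementary X b f g F" and g: "g \<in> l0 X"
  shows "Limsup (infty_on X \<times>\<^sub>F infty_on X) (\<lambda>(i, j). opt_dist X b F i j) \<le> 0"
proof (rule ereal_le_epsilon2)
  fix e :: real assume e: "0 < e"
  obtain L where "\<And>e. e > 0 \<Longrightarrow> \<exists>m. \<forall>i\<in>X. m \<le> \<bar>i\<bar> \<longrightarrow> \<bar>g i - L\<bar> < e"
    using l0_D[OF g] by blast
  from this[of "e / 2"] e have ev: "eventually (\<lambda>i. i \<in> X \<and> \<bar>g i - L\<bar> < e / 2) (infty_on X)"
    unfolding eventually_infty_on by auto
  have "eventually (\<lambda>p. (fst p \<in> X \<and> \<bar>g (fst p) - L\<bar> < e / 2)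
      \<and> (snd p \<in> X \<and> \<bar>g (snd p) - L\<bar> < e / 2)) (infty_on X \<times>\<^sub>F infty_on X)"
    using eventually_prodI[OF ev ev] .
  then have "eventually (\<lambda>p. (case p of (i, j) \<Rightarrow> opt_dist X b F i j) \<le> ereal e)
      (infty_on X \<times>\<^sub>F infty_on X)"
  proof (rule eventually_mono)
    fix p :: "int \<times> int"
    assume p: "(fst p \<in> X \<and> \<bar>g (fst p) - L\<bar> < e / 2)
      \<and> (snd p \<in> X \<and> \<bar>g (snd p) - L\<bar> < e / 2)"
    then have "g (fst p) - g (snd p) \<le> e" by linarith
    moreover have "opt_dist X b F (fst p) (snd p) \<le> ereal (g (fst p) - g (snd p))"
      using opt_dist_le[OF sc] p by blast
    ultimately show "(case p of (i, j) \<Rightarrow> opt_dist X b F i j) \<le> ereal e"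
      by (metis case_prod_unfold ereal_less_eq(3) order_trans)
  qed
  then show "Limsup (infty_on X \<times>\<^sub>F infty_on X) (\<lambda>(i, j). opt_dist X b F i j) \<le> 0 + ereal e"
    by (simp add: Limsup_bounded)
qed

lemma bounded_potentials:
  assumes sc: "strictly_complementary X b f g F" and g: "g \<in> l0 X"
  shows "bounded_fun_on X (potential X b F)" "bounded_fun_on X (inv_potential X b F)"
proof -
  obtain K where K: "\<forall>i\<in>X. \<bar>g i\<bar> \<le> K" using l0_bounded[OF g] by blast
  have up: "opt_dist X b F i j \<le> ereal (2 * K)" if "i \<in> X" "j \<in> X" for i j
  proof -
    have "opt_dist X b F i j \<le> ereal (g i - g j)" using opt_dist_le[OF sc that] .
    also have "\<dots> \<le> ereal (2 * K)" using bspec[OF K that(1)] bspec[OF K that(2)] by simp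
    finally show ?thesis .
  qed
  have "0 \<le> potential X b F i \<and> potential X b F i \<le> ereal (2 * K)" if "i \<in> X" for i
    unfolding potential_def using opt_dist_refl[OF sc that] up that
    by (auto intro: SUP_upper2 SUP_least)
  then show "bounded_fun_on X (potential X b F)"
    unfolding bounded_fun_on_def by (intro exI[of _ "2 * K"]) auto
  have "0 \<le> inv_potential X b F i \<and> inv_potential X b F i \<le> ereal (2 * K)" if "i \<in> X" for i
    unfolding inv_potential_def using opt_dist_refl[OF sc that] up that
    by (auto intro: SUP_upper2 SUP_least)
  then show "bounded_fun_on X (inv_potential X b F)"
    unfolding bounded_fun_on_def by (intro exI[of _ "2 * K"]) auto
qed

section \<open>Comparison with other assignments\<close>

text \<open>
  Where \<open>F\<close> and \<open>G\<close> differ, \<open>G\<close> picks an entry with positive slack; the slack at a single such index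
  already survives in every large block.
\<close>

lemma liminf_gain_pos:
  assumes sc: "strictly_complementary X b f g F" and G: "bij_betw G X X"
    and ne: "\<exists>i\<in>X. G i \<noteq> F i"
    and lim: "(\<lambda>n. \<Sum>i\<in>block X n. f (F i) - f (G i)) \<longlonglongrightarrow> 0"
  shows "liminf_gain X b F G > 0"
proof -
  obtain k where k: "k \<in> X" "G k \<noteq> F k" using ne by blast
  have GX: "G i \<in> X" if "i \<in> X" for i using G that by (rule bij_betw_apply)
  have "b k (G k) < ereal (g k + f (G k))"
    using complementaryD(4)[OF sc k(1) GX[OF k(1)] k(2)] .
  then obtain c where c: "b k (G k) < ereal c" "c < g k + f (G k)"
    using ereal_dense2 by force
  define d where "d = g k + f (G k) - c"
  have d: "d > 0" "b k (G k) \<le> ereal (g k + f (G k) - d)" using c by (auto simp: d_def)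
  have entry: "ereal (f (F i) - f (G i) + (if i = k then d else 0)) \<le> b i (F i) - b i (G i)"
    if i: "i \<in> X" for i
  proof -
    have "b i (G i) \<le> ereal (g i + f (G i) - (if i = k then d else 0))"
      using complementaryD(3)[OF sc i GX[OF i]] d by auto
    then have "ereal (g i + f (F i)) - ereal (g i + f (G i) - (if i = k then d else 0))
        \<le> b i (F i) - b i (G i)"
      unfolding complementaryD(2)[OF sc i] by (intro ereal_minus_mono) auto
    then show ?thesis by (simp add: algebra_simps)
  qed
  have "eventually (\<lambda>n. - (d / 2) < (\<Sum>i\<in>block X n. f (F i) - f (G i))) sequentially"
    using d lim by (intro order_tendstoD) auto
  moreover have "eventually (\<lambda>n. {k} \<subseteq> block X n) sequentially"
    using finite_subset_block[of "{k}" X] k unfolding eventually_sequentially by simp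
  ultimately have "eventually (\<lambda>n. ereal (d / 2) \<le> (\<Sum>i\<in>block X n. b i (F i) - b i (G i))) sequentially"
  proof eventually_elim
    case (elim n)
    have "d / 2 \<le> (\<Sum>i\<in>block X n. f (F i) - f (G i)) + d" using elim by linarith
    also have "\<dots> = (\<Sum>i\<in>block X n. f (F i) - f (G i) + (if i = k then d else 0))"
      using elim by (simp add: sum.distrib)
    finally have "ereal (d / 2)
        \<le> (\<Sum>i\<in>block X n. ereal (f (F i) - f (G i) + (if i = k then d else 0)))"
      by (simp add: sum_ereal)
    also have "\<dots> \<le> (\<Sum>i\<in>block X n. b i (F i) - b i (G i))"
      using block_subset entry by (intro sum_mono) blast
    finally show ?case .
  qed
  then have "ereal (d / 2) \<le> liminf_gain X b F G"
    unfolding liminf_gain_def by (rule Liminf_bounded)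
  with d(1) show ?thesis by (simp add: less_le_trans[of 0 "ereal (d / 2)"])
qed

text \<open>
  A bijection of displacement at most \<open>K\<close> maps the block of radius \<open>n\<close> onto a set lying between the
  blocks of radii \<open>n - K\<close> and \<open>n + K\<close>, which differ by at most \<open>4 * K\<close> points; there \<open>u\<close> is small.
\<close>

lemma block_sum_locally_bounded:
  assumes F: "bij_betw F X X" and K: "\<forall>i\<in>X. \<bar>F i - i\<bar> \<le> int K"
    and u: "\<And>e. e > 0 \<Longrightarrow> \<exists>m. \<forall>i\<in>X. m \<le> \<bar>i\<bar> \<longrightarrow> \<bar>u i\<bar> < (e :: real)"
  shows "(\<lambda>n. (\<Sum>i\<in>block X n. u (F i)) - (\<Sum>i\<in>block X (n - K). u i)) \<longlonglongrightarrow> 0"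
proof (rule LIMSEQ_I)
  fix r :: real assume r: "0 < r"
  define e where "e = r / (4 * real K + 1)"
  have e: "e > 0" "4 * real K * e < r" using r by (auto simp: e_def field_simps)
  obtain m where m: "\<forall>i\<in>X. m \<le> \<bar>i\<bar> \<longrightarrow> \<bar>u i\<bar> < e" using u[OF e(1)] by blast
  have "norm ((\<Sum>i\<in>block X n. u (F i)) - (\<Sum>i\<in>block X (n - K). u i) - 0) < r"
    if n: "n \<ge> K + nat m" for n
  proof -
    have inj: "inj_on F (block X n)"
      using F block_subset by (meson bij_betw_imp_inj_on inj_on_subset)
    let ?D = "F ` block X n - block X (n - K)"
    have inner: "block X (n - K) \<subseteq> F ` block X n"
    proof
      fix k assume k: "k \<in> block X (n - K)"
      then obtain i where i: "i \<in> X" "F i = k"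
        using F block_subset by (metis bij_betw_imp_surj_on imageE subsetD)
      have "\<bar>i\<bar> \<le> int n" using bspec[OF K i(1)] i(2) k n by (auto simp: block_def)
      with i show "k \<in> F ` block X n" by (auto simp: block_def)
    qed
    have shell: "?D \<subseteq> {- int n - int K..<int K - int n} \<union> {int n - int K<..int n + int K}"
    proof
      fix k assume k: "k \<in> ?D"
      then obtain i where i: "i \<in> X" "\<bar>i\<bar> \<le> int n" "k = F i" by (auto simp: block_def)
      have "k \<in> X" using F i by (simp add: bij_betw_apply)
      with k n have "\<bar>k\<bar> > int n - int K" by (auto simp: block_def)
      moreover have "\<bar>k\<bar> \<le> int n + int K" using bspec[OF K i(1)] i by linarith
      ultimately show "k \<in> {- int n - int K..<int K - int n} \<union> {int n - int K<..int n + int K}"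
        by auto
    qed
    have "card ?D \<le> card ({- int n - int K..<int K - int n} \<union> {int n - int K<..int n + int K})"
      using shell by (intro card_mono) auto
    also have "\<dots> \<le> card {- int n - int K..<int K - int n} + card {int n - int K<..int n + int K}"
      by (rule card_Un_le)
    also have "\<dots> = 4 * K" by simp
    finally have card: "card ?D \<le> 4 * K" .
    have small: "\<bar>u k\<bar> \<le> e" if "k \<in> ?D" for k
    proof -
      have "k \<in> X" using F that block_subset by (auto simp: bij_betw_apply subset_iff)
      moreover have "m \<le> \<bar>k\<bar>" using shell that n by force
      ultimately show ?thesis using m by (simp add: less_imp_le)
    qed
    have "(\<Sum>i\<in>block X n. u (F i)) = (\<Sum>k\<in>F ` block X n. u k)"
      using inj by (simp add: sum.reindex)
    then have "(\<Sum>i\<in>block X n. u (F i)) - (\<Sum>i\<in>block X (n - K). u i) = (\<Sum>k\<in>?D. u k)"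
      using inner by (simp add: sum_diff)
    also have "\<bar>\<dots>\<bar> \<le> (\<Sum>k\<in>?D. \<bar>u k\<bar>)" by (rule sum_abs)
    also have "\<dots> \<le> real (card ?D) * e" using small by (rule sum_bounded_above)
    also have "\<dots> \<le> 4 * real K * e" using card e(1) by (intro mult_right_mono) auto
    also note e(2)
    finally show ?thesis by simp
  qed
  then show "\<exists>no. \<forall>n\<ge>no. norm ((\<Sum>i\<in>block X n. u (F i)) - (\<Sum>i\<in>block X (n - K). u i) - 0) < r"
    by blast
qed

text \<open>
  Both sums run over equally many indices, so the limit of \<open>f\<close> may be subtracted from \<open>f\<close>.
\<close>

lemma block_sum_diff_l0:
  assumes F: "bij_betw F X X" "locally_bounded X F"
    and G: "bij_betw G X X" "locally_bounded X G"
    and f: "f \<in> l0 X"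
  shows "(\<lambda>n. \<Sum>i\<in>block X n. f (F i) - f (G i)) \<longlonglongrightarrow> 0"
proof -
  obtain K1 K2 :: nat where "\<forall>i\<in>X. \<bar>F i - i\<bar> \<le> int K1" "\<forall>i\<in>X. \<bar>G i - i\<bar> \<le> int K2"
    using F(2) G(2) unfolding locally_bounded_iff by blast
  then have KF: "\<forall>i\<in>X. \<bar>F i - i\<bar> \<le> int (max K1 K2)" and KG: "\<forall>i\<in>X. \<bar>G i - i\<bar> \<le> int (max K1 K2)"
    by fastforce+
  obtain L where L: "\<And>e. e > 0 \<Longrightarrow> \<exists>m. \<forall>i\<in>X. m \<le> \<bar>i\<bar> \<longrightarrow> \<bar>f i - L\<bar> < e"
    using l0_D[OF f] by blast
  show ?thesis
    using tendsto_diff[OF block_sum_locally_bounded[OF F(1) KF L]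
        block_sum_locally_bounded[OF G(1) KG L]]
    by (simp add: sum_subtractf)
qed

lemma block_sum_diff_l1:
  assumes F: "bij_betw F X X" and G: "bij_betw G X X" and f: "f \<in> l1 X"
  shows "(\<lambda>n. \<Sum>i\<in>block X n. f (F i) - f (G i)) \<longlonglongrightarrow> 0"
proof -
  have f': "f summable_on X"
    using l1_abs_summable[OF f] abs_summable_summable[of f X] by simp
  have "((\<lambda>i. f (H i)) has_sum infsum f X) X" if "bij_betw H X X" for H
    using has_sum_reindex_bij_betw[OF that, of f] has_sum_infsum[OF f'] by blast
  then have "(\<lambda>n. \<Sum>i\<in>block X n. f (H i)) \<longlonglongrightarrow> infsum f X" if "bij_betw H X X" for H
    using that filterlim_compose[OF _ filterlim_block] unfolding has_sum_def by blast
  from tendsto_diff[OF this[OF F] this[OF G]] show ?thesis by (simp add: sum_subtractf)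
qed

text \<open>
  For two distinct locally bounded local strong solutions the gain of either over the other would be
  eventually positive, although these gains are negatives of each other.
\<close>

lemma lb_local_strong_solution_unique:
  assumes fin: "\<forall>i\<in>X. \<forall>j\<in>X. b i j \<noteq> \<infinity>"
    and F: "local_strong_solution X b F" "locally_bounded X F"
    and G: "local_strong_solution X b G" "locally_bounded X G"
  shows "\<forall>i\<in>X. G i = F i"
proof (rule ccontr)
  assume ne: "\<not> ?thesis"
  have "rho X F G \<le> rho X F id + rho X id G" by (rule rho_triangle)
  also have "\<dots> < \<infinity>"
    using F(2) G(2) rho_symmetric[of X id G] by (simp add: locally_bounded_def)
  finally have rho: "rho X F G < \<infinity>" .
  have gain: "eventually (\<lambda>n. 0 < (\<Sum>i\<in>block X n. b i (H i) - b i (H' i))) sequentially"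
    if "liminf_gain X b H H' > 0" for H H'
    using that less_LiminfD unfolding liminf_gain_def by blast
  have "liminf_gain X b F G > 0"
    using F(1) G(1) ne rho unfolding local_strong_solution_def by blast
  moreover have "liminf_gain X b G F > 0"
    using F(1) G(1) ne rho rho_symmetric[of X F G] unfolding local_strong_solution_def by metis
  ultimately have "eventually (\<lambda>n. 0 < (\<Sum>i\<in>block X n. b i (F i) - b i (G i))
      \<and> 0 < (\<Sum>i\<in>block X n. b i (G i) - b i (F i))) sequentially"
    using gain eventually_conj by blast
  then obtain n where n: "0 < (\<Sum>i\<in>block X n. b i (F i) - b i (G i))"
    "0 < (\<Sum>i\<in>block X n. b i (G i) - b i (F i))"
    by (auto simp: eventually_sequentially)
  have real: "b i (H i) = ereal (real_of_ereal (b i (H i)))"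
    if "local_strong_solution X b H" "i \<in> block X n" for H i
  proof -
    have "i \<in> X" using that(2) block_subset by blast
    moreover have "H i \<in> X"
      using that(1) \<open>i \<in> X\<close> by (auto simp: local_strong_solution_def bij_betw_apply)
    ultimately have "\<bar>b i (H i)\<bar> \<noteq> \<infinity>"
      using that(1) fin by (auto simp: local_strong_solution_def)
    then show ?thesis by (simp add: ereal_real')
  qed
  have diff: "(\<Sum>i\<in>block X n. b i (H i) - b i (H' i))
      = ereal (\<Sum>i\<in>block X n. real_of_ereal (b i (H i)) - real_of_ereal (b i (H' i)))"
    if "local_strong_solution X b H" "local_strong_solution X b H'" for H H'
    unfolding sum_ereal[symmetric]
    using real[OF that(1)] real[OF that(2)] by (intro sum.cong) (auto, metis ereal_minus(1))
  from n show False
    unfolding diff[OF F(1) G(1)] diff[OF G(1) F(1)] by (simp add: sum_subtractf)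
qed

section \<open>Strong regularity yields the solution\<close>

lemma complementary_distinguished:
  assumes fin: "\<forall>i\<in>X. \<forall>j\<in>X. b i j \<noteq> \<infinity>" and C: "condition_C X b"
    and sc: "strictly_complementary X b f g F" and f: "f \<in> l0 X" and g: "g \<in> l0 X"
  shows "distinguished_solution X b F"
proof -
  have bij: "bij_betw F X X" using sc by (simp add: strictly_complementary_def)
  have lb: "locally_bounded X F" by (rule complementary_locally_bounded[OF sc C f g])
  have "liminf_gain X b F G > 0"
    if G: "bij_betw G X X" "\<exists>i\<in>X. G i \<noteq> F i" "rho X F G < \<infinity>" for G
  proof -
    have "rho X G id \<le> rho X G F + rho X F id" by (rule rho_triangle)
    also have "\<dots> < \<infinity>" using G(3) lb rho_symmetric[of X F G] by (simp add: locally_bounded_def)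
    finally have "locally_bounded X G" by (simp add: locally_bounded_def)
    then show ?thesis
      by (intro liminf_gain_pos[OF sc G(1,2)] block_sum_diff_l0 bij lb G(1) f)
  qed
  then have loc: "local_strong_solution X b F"
    unfolding local_strong_solution_def using bij complementaryD(2)[OF sc] by simp
  show ?thesis
    unfolding distinguished_solution_def lb_local_strong_l0_solution_def
    using loc lb complementary_values_l0[OF sc lb f g] Limsup_opt_dist[OF sc g]
      bounded_potentials[OF sc g] lb_local_strong_solution_unique[OF fin loc lb]
    by blast
qed

lemma complementary_global:
  assumes sc: "strictly_complementary X b f g F" and f: "f \<in> l1 X"
  shows "global_solution X b F"
proof -
  have bij: "bij_betw F X X" using sc by (simp add: strictly_complementary_def)
  have "liminf_gain X b F G > 0" if G: "bij_betw G X X" "\<exists>i\<in>X. G i \<noteq> F i" for G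
    by (rule liminf_gain_pos[OF sc G block_sum_diff_l1[OF bij G(1) f]])
  then show ?thesis
    unfolding global_solution_def using bij complementaryD(2)[OF sc] by (simp add: less_imp_le)
qed

theorem theorem1p2:
  fixes X :: "int set" and b :: "int \<Rightarrow> int \<Rightarrow> ereal"
  assumes "X = \<nat> \<or> X = \<int>"
    and "\<forall>i\<in>X. \<forall>j\<in>X. b i j \<noteq> \<infinity>"
    and "condition_C X b"
  shows "(strongly_regular X (l0 X) b \<longrightarrow> (\<exists>F. distinguished_solution X b F)) \<and>
         (strongly_regular X (l1 X) b \<longrightarrow>
            (\<exists>F. distinguished_solution X b F \<and>
                 global_solution X b F \<and> values_in X (l1 X) b F))"
proof (intro conjI impI)
  assume "strongly_regular X (l0 X) b"
  then obtain f g F where "f \<in> l0 X" "g \<in> l0 X" "strictly_complementary X b f g F"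
    using strongly_regular_complementary[OF assms(3)] by blast
  then show "\<exists>F. distinguished_solution X b F"
    using complementary_distinguished[OF assms(2,3)] by blast
next
  assume "strongly_regular X (l1 X) b"
  then obtain f g F where fg: "f \<in> l1 X" "g \<in> l1 X" and sc: "strictly_complementary X b f g F"
    using strongly_regular_complementary[OF assms(3) _ l1_subset_l0] by blast
  have "distinguished_solution X b F"
    using complementary_distinguished[OF assms(2,3) sc] fg l1_subset_l0 by blast
  then show "\<exists>F. distinguished_solution X b F \<and> global_solution X b F \<and> values_in X (l1 X) b F"
    using complementary_global[OF sc fg(1)] complementary_values_l1[OF sc fg] by blast
qed

end
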